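(* Let $Y:=\mathcal{C}^\infty([0,+\infty))\cap L^1([0,+\infty))$ and let $$\mathcal{A}^\infty := \left\{f\in Y : \limsup_{x\to+\infty}|f(x)|=+\infty\right\}.$$ Let $\mathcal{A}_0^\infty$ be the set of sequences $(f_n)_n$ of functions in $\mathcal{A}^\infty$ such that $f_n\to 0$ in $L^1$-norm and almost uniformly in $[0,+\infty)$. Then both $\mathcal{A}^\infty$ and $\mathcal{A}_0^\infty$ are maximal lineable; that is, there is a vector subspace $M\subset Y$ with $\dim(M)=\dim(Y)$ and $M\setminus\{0\}\subset\mathcal{A}^\infty$, and there is a vector subspace $M_0\subset Y^{\mathbb{N}}$ with $\dim(M_0)=\dim(Y^{\mathbb{N}})$ and $M_0\setminus\{0\}\subset\mathcal{A}_0^\infty$.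
   Context: $\mathcal{C}^\infty([0,+\infty))$ is the real vector space of infinitely differentiable functions $[0,+\infty)\to\mathbb{R}$, and $L^1([0,+\infty))$ is the space of Lebesgue integrable functions on $[0,+\infty)$ with norm $\|f\|_{L^1}=\int_0^\infty|f(x)|\,dx$. $Y^{\mathbb{N}}$ is the vector space of all sequences in $Y$ with componentwise operations. Dimension means algebraic (Hamel) dimension over $\mathbb{R}$; $\dim(Y)=\dim(Y^{\mathbb{N}})=\mathfrak{c}$, the cardinality of the continuum. A subset $A$ of a vector space $Z$ is maximal lineable if there is an infinite-dimensional vector subspace $M$ of $Z$ with $\dim(M)=\dim(Z)$ and $M\setminus\{0\}\subset A$. A sequence $f_n\to f$ almost uniformly on $[0,+\infty)$ if for every $\varepsilon>0$ there is a (measurable) set $E\subset[0,+\infty)$ with $m(E)\le\varepsilon$ such that $f_n\to f$ uniformly on $[0,+\infty)\setminus E$, where $m$ is Lebesgue measure. *)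

theory Defs
  imports "HOL-Analysis.Analysis" "HOL-Library.Function_Algebras"
begin

unbundle cardinal_syntax
no_notation Set_Algebras.elt_set_eq (infix \<open>=o\<close> 50)

text \<open>
  Functions into a real vector space form a real vector space pointwise (the group structure is that
  of Function_Algebras). This makes subspace, span and independent available for functions and,
  by iteration, for sequences of functions.
\<close>

instantiation "fun" :: (type, real_vector) real_vector
begin

definition scaleR_fun_def: "scaleR c f = (\<lambda>x. c *\<^sub>R f x)"

instance
  by standard (auto simp: scaleR_fun_def fun_eq_iff algebra_simps)

end

lemma scaleR_fun_apply [simp]: "(c *\<^sub>R f) x = c *\<^sub>R f x"
  by (simp add: scaleR_fun_def)


definition hamel_basis :: "'v::real_vector set \<Rightarrow> 'v set \<Rightarrow> bool" where
  "hamel_basis B V \<longleftrightarrow> independent B \<and> span B = V"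

text \<open>
  The library dimension is a natural number, which does not distinguish infinite cardinals.
  Here the dimension is a cardinal, to be compared with \<open>=o\<close>; for a subspace a basis exists and
  the choice is irrelevant, as shown below.
\<close>

definition hamel_dim :: "'v::real_vector set \<Rightarrow> 'v rel" where
  "hamel_dim V = |SOME B. hamel_basis B V|"

definition infinite_dimensional :: "'v::real_vector set \<Rightarrow> bool" where
  "infinite_dimensional V \<longleftrightarrow> \<not> (\<exists>B. finite B \<and> hamel_basis B V)"

definition maximal_lineable :: "'v::real_vector set \<Rightarrow> 'v set \<Rightarrow> bool" where
  "maximal_lineable Z A \<longleftrightarrow> A \<subseteq> Z \<and>
     (\<exists>M. subspace M \<and> M \<subseteq> Z \<and> infinite_dimensional M \<and> hamel_dim M =o hamel_dim Z \<and> M - {0} \<subseteq> A)"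

lemma hamel_basis_exists:
  assumes "subspace V"
  shows "\<exists>B. hamel_basis B V"
proof -
  obtain B where "B \<subseteq> V" "independent B" "V \<subseteq> span B"
    using maximal_independent_subset by blast
  with assms have "span B = V"
    using span_minimal[of B V] by blast
  with \<open>independent B\<close> show ?thesis
    unfolding hamel_basis_def by blast
qed

lemma hamel_basis_le:
  assumes B: "hamel_basis B V" and C: "hamel_basis C V"
  shows "|B| \<le>o |C|"
proof (cases "finite C")
  case True
  have "B \<subseteq> span C"
    using B C span_superset[of B] by (simp add: hamel_basis_def)
  then have "finite B \<and> card B \<le> card C"
    using True B independent_span_bound unfolding hamel_basis_def by blast
  with True show ?thesis
    using inj_on_iff_card_le[of B C] card_of_ordLeq[of B C] by blast
next
  case False
  have "\<exists>S. finite S \<and> S \<subseteq> B \<and> c \<in> span S" if "c \<in> C" for c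
  proof -
    have "c \<in> span B"
      using that B C span_superset[of C] by (auto simp: hamel_basis_def)
    then obtain S r where "finite S" "S \<subseteq> B" "c = (\<Sum>a\<in>S. r a *\<^sub>R a)"
      unfolding span_explicit by blast
    then have "c \<in> span S"
      by (auto intro: span_sum span_scale span_base)
    with \<open>finite S\<close> \<open>S \<subseteq> B\<close> show ?thesis
      by blast
  qed
  then obtain S where S: "\<And>c. c \<in> C \<Longrightarrow> finite (S c) \<and> S c \<subseteq> B \<and> c \<in> span (S c)"
    by metis
  define U where "U = (\<Union>c\<in>C. S c)"
  have "C \<subseteq> span U"
  proof
    fix c assume "c \<in> C"
    then have "c \<in> span (S c)" "S c \<subseteq> U"
      using S by (auto simp: U_def)
    then show "c \<in> span U"
      using span_mono[of "S c" U] by blast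
  qed
  then have BU: "B \<subseteq> span U"
    using B C span_minimal[of C "span U"] span_superset[of B] unfolding hamel_basis_def by auto
  have UB: "U \<subseteq> B"
    using S unfolding U_def by blast
  have "B \<subseteq> U"
  proof
    fix b assume b: "b \<in> B"
    show "b \<in> U"
    proof (rule ccontr)
      assume "b \<notin> U"
      then have "b \<in> span (B - {b})"
        using BU UB b span_mono[of U "B - {b}"] by blast
      with b B show False
        unfolding hamel_basis_def dependent_def by blast
    qed
  qed
  moreover have "|U| \<le>o |C|"
    unfolding U_def
  proof (rule card_of_UNION_ordLeq_infinite[OF False])
    show "|C| \<le>o |C|"
      by (rule ordLeq_refl[OF card_of_Card_order])
    show "\<forall>c\<in>C. |S c| \<le>o |C|"
    proof
      fix c assume "c \<in> C"
      then have "|S c| <o natLeq"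
        using S finite_iff_ordLess_natLeq by blast
      moreover have "natLeq \<le>o |C|"
        using False infinite_iff_natLeq_ordLeq by blast
      ultimately show "|S c| \<le>o |C|"
        using ordLess_ordLeq_trans ordLess_imp_ordLeq by blast
    qed
  qed
  ultimately show ?thesis
    using UB by (simp add: subset_antisym)
qed

lemma hamel_dim_eq:
  assumes "hamel_basis B V"
  shows "hamel_dim V =o |B|"
proof -
  have "hamel_basis (SOME B. hamel_basis B V) V"
    using assms by (rule someI)
  then show ?thesis
    using assms unfolding hamel_dim_def by (simp add: hamel_basis_le ordIso_iff_ordLeq)
qed


text \<open>
  A function on \<open>[0,\<infinity>)\<close> is represented by its extension by 0 to the negative reals, so that
  equality and the vector space operations are those of functions on \<open>[0,\<infinity>)\<close>. At the
  endpoint the derivatives are one-sided; \<open>D n\<close> is the derivative of order \<open>n\<close>.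
\<close>

definition smooth_halfline :: "(real \<Rightarrow> real) set" where
  "smooth_halfline = {f. (\<forall>x<0. f x = 0) \<and>
     (\<exists>D :: nat \<Rightarrow> real \<Rightarrow> real. (\<forall>x\<ge>0. D 0 x = f x) \<and>
        (\<forall>n. \<forall>x\<ge>0. (D n has_real_derivative D (Suc n) x) (at x within {0..})))}"

definition Y_space :: "(real \<Rightarrow> real) set" where
  "Y_space = {f \<in> smooth_halfline. set_integrable lebesgue {0..} f}"

definition Y_seq :: "(nat \<Rightarrow> real \<Rightarrow> real) set" where
  "Y_seq = {F. \<forall>n. F n \<in> Y_space}"

definition L1_norm :: "(real \<Rightarrow> real) \<Rightarrow> real" where
  "L1_norm f = (LINT x:{0..}|lebesgue. \<bar>f x\<bar>)"

definition almost_uniform_limit :: "(nat \<Rightarrow> real \<Rightarrow> real) \<Rightarrow> (real \<Rightarrow> real) \<Rightarrow> bool" where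
  "almost_uniform_limit F f \<longleftrightarrow>
     (\<forall>\<epsilon>>0. \<exists>E. E \<subseteq> {0..} \<and> E \<in> sets lebesgue \<and> emeasure lebesgue E \<le> ennreal \<epsilon> \<and>
        uniform_limit ({0..} - E) F f sequentially)"

definition A_inf :: "(real \<Rightarrow> real) set" where
  "A_inf = {f \<in> Y_space. Limsup at_top (\<lambda>x. ereal \<bar>f x\<bar>) = \<infinity>}"

definition A0_inf :: "(nat \<Rightarrow> real \<Rightarrow> real) set" where
  "A0_inf = {F. (\<forall>n. F n \<in> A_inf) \<and> (\<lambda>n. L1_norm (F n)) \<longlonglongrightarrow> 0 \<and>
     almost_uniform_limit F (\<lambda>x. 0)}"

lemma subspace_Y_space: "subspace Y_space"
proof (rule subspaceI)
  show "0 \<in> Y_space"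
    unfolding Y_space_def smooth_halfline_def
    by (auto simp: set_integrable_def intro!: exI[of _ "\<lambda>_ _. 0"])
next
  fix f g assume fg: "f \<in> Y_space" "g \<in> Y_space"
  then obtain D D' where D: "\<forall>x\<ge>0. D 0 x = f x"
      "\<forall>n. \<forall>x\<ge>0. (D n has_real_derivative D (Suc n) x) (at x within {0..})"
    and D': "\<forall>x\<ge>0. D' 0 x = g x"
      "\<forall>n. \<forall>x\<ge>0. (D' n has_real_derivative D' (Suc n) x) (at x within {0..})"
    unfolding Y_space_def smooth_halfline_def by blast
  have "\<exists>D. (\<forall>x\<ge>0. D 0 x = (f + g) x) \<and>
        (\<forall>n. \<forall>x\<ge>0. (D n has_real_derivative D (Suc n) x) (at x within {0..}))"
    by (rule exI[of _ "\<lambda>n x. D n x + D' n x"]) (use D D' in \<open>auto intro: DERIV_add\<close>)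
  moreover have "set_integrable lebesgue {0..} (f + g)"
    using fg set_integral_add(1)[of lebesgue "{0..}" f g] by (simp add: Y_space_def plus_fun_def)
  ultimately show "f + g \<in> Y_space"
    using fg by (simp add: Y_space_def smooth_halfline_def)
next
  fix c f assume f: "f \<in> Y_space"
  then obtain D where D: "\<forall>x\<ge>0. D 0 x = f x"
      "\<forall>n. \<forall>x\<ge>0. (D n has_real_derivative D (Suc n) x) (at x within {0..})"
    unfolding Y_space_def smooth_halfline_def by blast
  have "\<exists>D. (\<forall>x\<ge>0. D 0 x = (c *\<^sub>R f) x) \<and>
        (\<forall>n. \<forall>x\<ge>0. (D n has_real_derivative D (Suc n) x) (at x within {0..}))"
    by (rule exI[of _ "\<lambda>n x. c * D n x"]) (use D in \<open>auto intro: DERIV_cmult\<close>)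
  moreover have "set_integrable lebesgue {0..} (c *\<^sub>R f)"
    using f by (simp add: Y_space_def scaleR_fun_def)
  ultimately show "c *\<^sub>R f \<in> Y_space"
    using f by (simp add: Y_space_def smooth_halfline_def)
qed

lemma subspace_Y_seq: "subspace Y_seq"
  using subspace_Y_space by (simp add: Y_seq_def subspace_def)

end

theory Submission
  imports Defs "HOL-Real_Asymp.Real_Asymp" "HOL-Probability.Distributions" "HOL-Complex_Analysis.Cauchy_Integral_Formula"
begin

text \<open>
  For \<open>0 < t < 1\<close> let \<open>spike t x = exp (t x - exp (4 x + 2) sin\<^sup>2 (\<pi> x))\<close>. At an integer \<open>n\<close>
  the sine vanishes and the value is \<open>exp (t n)\<close>. In between, the factor \<open>exp (4 x + 2)\<close> squeezes
  the graph into a peak around \<open>n\<close> of width about \<open>exp (- 2 n)\<close>, which outweighs the height, so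
  the spike is integrable (\<open>integrable_spike\<close>). It is smooth because the formula defines an entire
  function.

  In a linear combination of spikes with nonzero coefficients the largest exponent wins along the
  integers, so every nontrivial combination is unbounded there (\<open>spike_combination_at_top\<close>). This
  gives both the linear independence of the spikes and the fact that their span avoids everything
  outside \<open>A_inf\<close> except \<open>0\<close>. There are continuum many parameters \<open>t\<close>.

  For sequences no new functions are needed: every \<open>f\<close> in the span is turned into the sequence
  \<open>f / (n + 1)\<close>. Its \<open>L\<^sup>1\<close> norms tend to \<open>0\<close> trivially, and it tends to \<open>0\<close> almost
  uniformly because by Markov's inequality an integrable function is bounded off a set of small
  measure (\<open>almost_uniform_limit_divide\<close>). The map is linear and injective, so dimension is kept.

  It remains to see that the continuum is the largest dimension possible. A function in \<open>Y_space\<close>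
  is determined by its values at the rationals, hence a sequence of such functions is coded by a
  set of triples in \<open>\<nat> \<times> \<rat> \<times> \<rat>\<close> (\<open>card_Y_seq_le\<close>), and a basis is no larger than the space
  that contains it.
\<close>

(* Below, =o is the equality of cardinals only. *)
no_notation Set_Algebras.elt_set_eq (infix \<open>=o\<close> 50)

section \<open>Spike functions\<close>

definition spike :: "real \<Rightarrow> real \<Rightarrow> real" where
  "spike t x = (if x < 0 then 0 else exp (t * x - exp (4 * x + 2) * (sin (pi * x))\<^sup>2))"

lemma spike_of_nat: "spike t (real n) = exp (t * real n)"
  by (simp add: spike_def mult.commute[of pi])

text \<open>
  The derivatives of all orders come for free from the complex ones, since the real part of a
  complex derivative along the real axis is the real derivative.
\<close>

lemma smooth_halfline_if_entire:
  assumes F: "F holomorphic_on UNIV"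
    and f: "\<And>x. x \<ge> 0 \<Longrightarrow> f x = Re (F (of_real x))" "\<And>x. x < 0 \<Longrightarrow> f x = 0"
  shows "f \<in> smooth_halfline"
proof -
  define D where "D n x = Re ((deriv ^^ n) F (of_real x))" for n and x :: real
  have "(D n has_real_derivative D (Suc n) x) (at x within {0..})" for n x
  proof -
    have "(deriv ^^ n) F holomorphic_on UNIV"
      using F by (intro holomorphic_higher_deriv) auto
    then have "((deriv ^^ n) F has_field_derivative (deriv ^^ Suc n) F (of_real x)) (at (of_real x))"
      using holomorphic_derivI by fastforce
    then have "(((\<lambda>x. (deriv ^^ n) F (of_real x))) has_vector_derivative (deriv ^^ Suc n) F (of_real x))
        (at x within {0..})"
      by (rule has_vector_derivative_real_field)
    then show ?thesis
      unfolding D_def by (rule has_field_derivative_Re)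
  qed
  moreover have "D 0 x = f x" if "x \<ge> 0" for x
    using that f by (simp add: D_def)
  ultimately show ?thesis
    using f(2) unfolding smooth_halfline_def by blast
qed

lemma smooth_spike: "spike t \<in> smooth_halfline"
proof (rule smooth_halfline_if_entire)
  let ?F = "\<lambda>z::complex. exp (of_real t * z - exp (4 * z + 2) * (sin (of_real pi * z))\<^sup>2)"
  show "?F holomorphic_on UNIV"
    by (intro holomorphic_intros)
  show "spike t x = Re (?F (of_real x))" if "x \<ge> 0" for x
  proof -
    have "?F (of_real x) = of_real (spike t x)"
      using that by (simp add: spike_def exp_of_real[symmetric] sin_of_real[symmetric])
    then show ?thesis by simp
  qed
qed (simp add: spike_def)

text \<open>
  A weak form of Jordan's inequality \<open>\<bar>sin (\<pi> u)\<bar> \<ge> 2 \<bar>u\<bar>\<close>, which the crude bounds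
  \<open>3 < \<pi> < 4\<close> and the Taylor polynomial \<open>y - y\<^sup>3 / 6\<close> are enough for.
\<close>

lemma sin_pi_lower_bound:
  fixes u :: real
  assumes "\<bar>u\<bar> \<le> 1/2"
  shows "u\<^sup>2 \<le> (sin (pi * u))\<^sup>2"
proof -
  define y where "y = pi * u"
  have y: "\<bar>y\<bar> \<le> 2"
    using assms mult_mono[of pi 4 "\<bar>u\<bar>" "1/2"] pi_less_4 by (simp add: y_def abs_mult)
  have "\<bar>sin y - (\<Sum>m<3. sin_coeff m * y ^ m)\<bar> \<le> inverse (fact 3) * \<bar>y\<bar> ^ 3"
    by (rule Maclaurin_sin_bound)
  then have "\<bar>sin y - y\<bar> \<le> \<bar>y\<bar> ^ 3 / 6"
    by (simp add: eval_nat_numeral sin_coeff_def)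
  moreover have "\<bar>y\<bar> ^ 3 / 6 \<le> \<bar>y\<bar> * 4 / 6"
    using y mult_left_mono[of "\<bar>y\<bar>\<^sup>2" "2\<^sup>2" "\<bar>y\<bar>"] power_mono[of "\<bar>y\<bar>" 2 2]
    by (simp add: eval_nat_numeral)
  ultimately have "\<bar>y\<bar> / 3 \<le> \<bar>sin y\<bar>"
    by (simp add: abs_if split: if_splits)
  moreover have "\<bar>u\<bar> \<le> \<bar>y\<bar> / 3"
    using pi_gt3 mult_right_mono[of 3 pi "\<bar>u\<bar>"] by (simp add: y_def abs_mult)
  ultimately show ?thesis
    using abs_le_square_iff[of u "sin y"] by (simp add: y_def)
qed

text \<open>
  Near the integer \<open>n\<close> closest to \<open>x\<close> the sine behaves like \<open>x - n\<close>, so the spike lies below a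
  Gaussian of standard deviation \<open>exp (- 2 n)\<close>. Writing that Gaussian as a multiple of a normal
  density makes its integral known, and the factor \<open>exp (- n)\<close> is what is left after the
  height \<open>exp (t n) \<le> exp n\<close> has been paid for.
\<close>

lemma spike_le_normal_density:
  assumes "t \<le> 1" "x \<ge> 0"
  shows "\<exists>n. spike t x
    \<le> exp (1/2) * sqrt (2 * pi) * exp (- real n) * normal_density (real n) (exp (- 2 * real n)) x"
proof
  (* The 2 in the exponent of the spike absorbs the error x >= n - 1/2. *)
  define n where "n = nat (round x)"
  define u where "u = x - real n"
  have n: "real n = of_int (round x)"
    using assms by (simp add: n_def of_nat_nat round_mono[of 0 x, simplified])
  have u: "\<bar>u\<bar> \<le> 1/2"
    using of_int_round_abs_le[of x] by (simp add: u_def n abs_minus_commute)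
  have x: "x = u + real n"
    by (simp add: u_def)
  have "sin (pi * x) = sin (pi * u) * cos (pi * real n)"
    by (simp add: x ring_distribs sin_add mult.commute[of pi "real n"])
  then have "u\<^sup>2 \<le> (sin (pi * x))\<^sup>2"
    using sin_pi_lower_bound[OF u] by (simp add: power_mult_distrib mult.commute[of pi "real n"] flip: power_mult)
  moreover have "exp (4 * real n) \<le> exp (4 * x + 2)"
    using u by (simp add: x)
  ultimately have "exp (4 * real n) * u\<^sup>2 \<le> exp (4 * x + 2) * (sin (pi * x))\<^sup>2"
    by (intro mult_mono) auto
  moreover have "exp (4 * real n) * u\<^sup>2 / 2 \<le> exp (4 * real n) * u\<^sup>2"
    by simp
  moreover have "t * x \<le> 1/2 + real n"
    using assms u mult_right_mono[of t 1 x] by (simp add: x)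
  ultimately have "t * x - exp (4 * x + 2) * (sin (pi * x))\<^sup>2 \<le> 1/2 + real n - exp (4 * real n) * u\<^sup>2 / 2"
    by linarith
  then have "spike t x \<le> exp (1/2 + real n - exp (4 * real n) * u\<^sup>2 / 2)"
    using assms by (simp add: spike_def)
  also have "\<dots> = exp (1/2) * sqrt (2 * pi) * exp (- real n) * normal_density (real n) (exp (- 2 * real n)) x"
  proof -
    have "(exp (- 2 * real n))\<^sup>2 = exp (- 4 * real n)"
      by (simp add: exp_double[symmetric])
    then have 1: "- (x - real n)\<^sup>2 / (2 * (exp (- 2 * real n))\<^sup>2) = - (exp (4 * real n) * u\<^sup>2 / 2)"
      by (simp add: u_def exp_minus field_simps)
    have 2: "sqrt (2 * pi * (exp (- 2 * real n))\<^sup>2) = sqrt (2 * pi) * exp (- 2 * real n)"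
      by (simp add: real_sqrt_mult)
    have 3: "exp (- real n) = exp (real n) * exp (- 2 * real n)"
      by (simp add: exp_add[symmetric])
    have 4: "exp (1/2 + real n - exp (4 * real n) * u\<^sup>2 / 2)
        = exp (1/2) * exp (real n) * exp (- (exp (4 * real n) * u\<^sup>2 / 2))"
      by (simp add: exp_add[symmetric])
    show ?thesis
      unfolding normal_density_def 1 2 3 4 by simp
  qed
  finally show "spike t x \<le> \<dots>" .
qed

lemma nn_integral_normal_density:
  assumes "\<sigma> > 0"
  shows "(\<integral>\<^sup>+x. ennreal (normal_density \<mu> \<sigma> x) \<partial>lborel) = 1"
  using assms by (simp add: nn_integral_eq_integral)

text \<open>
  The Gaussians around all integers are added up without cutting them off, so no decomposition of
  the half-line is needed; their integrals form a geometric series.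
\<close>

lemma integrable_spike:
  assumes "t \<le> 1"
  shows "integrable lborel (spike t)"
proof (rule integrableI_bounded)
  show "spike t \<in> borel_measurable lborel"
    unfolding spike_def by measurable
  define C where "C n = exp (1/2) * sqrt (2 * pi) * exp (- real n)" for n
  let ?N = "\<lambda>n. normal_density (real n) (exp (- 2 * real n))"
  have "(\<integral>\<^sup>+x. ennreal (norm (spike t x)) \<partial>lborel) \<le> (\<integral>\<^sup>+x. (\<Sum>n. ennreal (C n * ?N n x)) \<partial>lborel)"
  proof (rule nn_integral_mono)
    fix x :: real
    show "ennreal (norm (spike t x)) \<le> (\<Sum>n. ennreal (C n * ?N n x))"
    proof (cases "x < 0")
      case False
      then obtain n where "spike t x \<le> C n * ?N n x"
        using spike_le_normal_density[OF assms, of x] by (auto simp: C_def)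
      moreover have "0 \<le> spike t x"
        by (simp add: spike_def)
      ultimately have "ennreal (norm (spike t x)) \<le> ennreal (C n * ?N n x)"
        by (simp add: ennreal_leI)
      also have "\<dots> \<le> (\<Sum>n. ennreal (C n * ?N n x))"
        using sum_le_suminf[of "\<lambda>n. ennreal (C n * ?N n x)" "{n}"] by simp
      finally show ?thesis .
    qed (simp add: spike_def)
  qed
  also have "\<dots> = (\<Sum>n. \<integral>\<^sup>+x. ennreal (C n * ?N n x) \<partial>lborel)"
    by (intro nn_integral_suminf) measurable
  also have "\<dots> = (\<Sum>n. ennreal (C n))"
    by (simp add: ennreal_mult C_def nn_integral_cmult nn_integral_normal_density)
  also have "\<dots> < \<infinity>"
  proof -
    have "C = (\<lambda>n. exp (1/2) * sqrt (2 * pi) * exp (- 1) ^ n)"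
      by (simp add: C_def fun_eq_iff exp_of_nat_mult[symmetric])
    then have "summable C"
      by (auto intro!: summable_mult summable_geometric)
    moreover have "C n \<ge> 0" for n
      by (simp add: C_def)
    ultimately have "(\<Sum>n. ennreal (C n)) \<noteq> top"
      by (intro ennreal_suminf_neq_top)
    then show ?thesis
      by (simp add: less_top)
  qed
  finally show "(\<integral>\<^sup>+x. ennreal (norm (spike t x)) \<partial>lborel) < \<infinity>" .
qed

lemma spike_in_Y_space:
  assumes "t \<le> 1"
  shows "spike t \<in> Y_space"
proof -
  have "integrable lebesgue (spike t)"
    using integrable_spike[OF assms] by (simp add: integrable_completion)
  then have "set_integrable lebesgue UNIV (spike t)"
    by (simp add: set_integrable_def)
  then have "set_integrable lebesgue {0..} (spike t)"
    by (rule set_integrable_subset) auto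
  then show ?thesis
    by (simp add: Y_space_def smooth_spike)
qed


section \<open>Unboundedness of linear combinations\<close>

text \<open>
  Divide by the exponential with the largest exponent \<open>m\<close> that has a nonzero coefficient: what
  remains tends to that coefficient, while \<open>exp (m n)\<close> tends to infinity as \<open>m > 0\<close>.
\<close>

lemma exp_combination_at_top:
  fixes c :: "real \<Rightarrow> real"
  assumes T: "finite T" "T \<subseteq> {0<..}" and c: "\<exists>t\<in>T. c t \<noteq> 0"
  shows "filterlim (\<lambda>n. \<bar>\<Sum>t\<in>T. c t * exp (t * real n)\<bar>) at_top sequentially"
proof -
  define S where "S = {t \<in> T. c t \<noteq> 0}"
  define m where "m = Max S"
  have S: "finite S" "S \<noteq> {}"
    using T c by (auto simp: S_def)
  then have m: "m \<in> S" "\<And>t. t \<in> S \<Longrightarrow> t \<le> m"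
    by (auto simp: m_def)
  then have m0: "m > 0" "c m \<noteq> 0"
    using T by (auto simp: S_def)
  have factored: "(\<Sum>t\<in>T. c t * exp (t * real n)) = exp (m * real n) * (c m + (\<Sum>t\<in>S-{m}. c t * exp ((t - m) * real n)))"
    for n
  proof -
    have "(\<Sum>t\<in>T. c t * exp (t * real n)) = (\<Sum>t\<in>S. c t * exp (t * real n))"
      using T by (intro sum.mono_neutral_right) (auto simp: S_def)
    also have "\<dots> = c m * exp (m * real n) + (\<Sum>t\<in>S-{m}. c t * exp (t * real n))"
      using S m by (simp add: sum.remove)
    also have "(\<Sum>t\<in>S-{m}. c t * exp (t * real n)) = (\<Sum>t\<in>S-{m}. exp (m * real n) * (c t * exp ((t - m) * real n)))"
      by (intro sum.cong) (auto simp: exp_diff left_diff_distrib)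
    finally show ?thesis
      by (simp add: sum_distrib_left distrib_left)
  qed
  have "(\<lambda>n. c t * exp ((t - m) * real n)) \<longlonglongrightarrow> 0" if "t \<in> S - {m}" for t
  proof -
    have "t < m"
      using that m by force
    then show ?thesis
      by real_asymp
  qed
  then have "(\<lambda>n. \<bar>c m + (\<Sum>t\<in>S-{m}. c t * exp ((t - m) * real n))\<bar>) \<longlonglongrightarrow> \<bar>c m + 0\<bar>"
    by (intro tendsto_rabs tendsto_add tendsto_const tendsto_null_sum) auto
  moreover have "filterlim (\<lambda>n. exp (m * real n)) at_top sequentially"
    using m0 by real_asymp
  ultimately have "filterlim (\<lambda>n. \<bar>c m + (\<Sum>t\<in>S-{m}. c t * exp ((t - m) * real n))\<bar> * exp (m * real n)) at_top sequentially"
    using m0 by (intro filterlim_tendsto_pos_mult_at_top[where c = "\<bar>c m\<bar>"]) auto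
  then show ?thesis
    by (simp add: factored abs_mult mult.commute)
qed

lemma Limsup_abs_eq_infinity:
  fixes f :: "real \<Rightarrow> real"
  assumes "filterlim (\<lambda>n. \<bar>f (real n)\<bar>) at_top sequentially"
  shows "Limsup at_top (\<lambda>x. ereal \<bar>f x\<bar>) = \<infinity>"
proof (rule ccontr)
  assume "Limsup at_top (\<lambda>x. ereal \<bar>f x\<bar>) \<noteq> \<infinity>"
  then have "Limsup at_top (\<lambda>x. ereal \<bar>f x\<bar>) < \<infinity>"
    by simp
  from ereal_dense2[OF this] obtain K where "Limsup at_top (\<lambda>x. ereal \<bar>f x\<bar>) < ereal K"
    by blast
  then have "eventually (\<lambda>x. \<bar>f x\<bar> < K) at_top"
    using Limsup_lessD by fastforce
  then have "eventually (\<lambda>n. \<bar>f (real n)\<bar> < K) sequentially"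
    using filterlim_real_sequentially by (rule eventually_compose_filterlim)
  moreover have "eventually (\<lambda>n. K \<le> \<bar>f (real n)\<bar>) sequentially"
    using assms by (simp add: filterlim_at_top)
  ultimately have "eventually (\<lambda>n::nat. False) sequentially"
    by eventually_elim simp
  then show False
    by simp
qed

lemma sum_fun_apply: "(\<Sum>i\<in>I. g i) x = (\<Sum>i\<in>I. g i x)"
  by (induction I rule: infinite_finite_induct) auto

lemma spike_combination_at_top:
  assumes "finite T" "T \<subseteq> {0<..}" "\<exists>t\<in>T. c t \<noteq> 0"
  shows "filterlim (\<lambda>n. \<bar>(\<Sum>t\<in>T. c t *\<^sub>R spike t) (real n)\<bar>) at_top sequentially"
  using exp_combination_at_top[OF assms] by (simp add: sum_fun_apply spike_of_nat)

lemma spike_combination_nonzero: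
  assumes "finite T" "T \<subseteq> {0<..}" "\<exists>t\<in>T. c t \<noteq> 0"
  shows "(\<Sum>t\<in>T. c t *\<^sub>R spike t) \<noteq> 0"
proof
  assume "(\<Sum>t\<in>T. c t *\<^sub>R spike t) = 0"
  with spike_combination_at_top[OF assms] have "filterlim (\<lambda>n. 0::real) at_top sequentially"
    by simp
  then have "eventually (\<lambda>n::nat. (1::real) \<le> 0) sequentially"
    unfolding filterlim_at_top by blast
  then show False
    by simp
qed

lemma inj_spike: "inj spike"
proof (rule injI)
  fix s t assume "spike s = spike t"
  then have "spike s (real 1) = spike t (real 1)"
    by simp
  then show "s = t"
    unfolding spike_of_nat by simp
qed

lemma independent_imageI:
  fixes g :: "'i \<Rightarrow> 'v::real_vector"
  assumes "\<And>T c. finite T \<Longrightarrow> T \<subseteq> I \<Longrightarrow> \<exists>t\<in>T. c t \<noteq> 0 \<Longrightarrow> (\<Sum>t\<in>T. c t *\<^sub>R g t) \<noteq> 0"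
  shows "independent (g ` I)"
proof
  assume "dependent (g ` I)"
  then obtain U u where U: "finite U" "U \<subseteq> g ` I" "\<exists>v\<in>U. u v \<noteq> 0" "(\<Sum>v\<in>U. u v *\<^sub>R v) = 0"
    unfolding dependent_explicit by blast
  obtain T where T: "T \<subseteq> I" "inj_on g T" "U = g ` T"
    using U(2) subset_image_inj[of U g I] by metis
  have "finite T"
    using T U(1) by (simp add: finite_image_iff)
  moreover have "(\<Sum>t\<in>T. u (g t) *\<^sub>R g t) = 0"
    using T U(4) by (simp add: sum.reindex)
  moreover have "\<exists>t\<in>T. u (g t) \<noteq> 0"
    using T U(3) by blast
  ultimately show False
    using assms[of T "\<lambda>t. u (g t)"] T(1) by simp
qed

lemma span_image_explicit:
  fixes g :: "'i \<Rightarrow> 'v::real_vector"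
  assumes "f \<in> span (g ` I)"
  obtains T c where "finite T" "T \<subseteq> I" "f = (\<Sum>t\<in>T. c t *\<^sub>R g t)"
proof -
  obtain U u where U: "finite U" "U \<subseteq> g ` I" "f = (\<Sum>v\<in>U. u v *\<^sub>R v)"
    using assms unfolding span_explicit by blast
  obtain T where T: "T \<subseteq> I" "inj_on g T" "U = g ` T"
    using U(2) subset_image_inj[of U g I] by metis
  have "finite T"
    using T U(1) by (simp add: finite_image_iff)
  moreover have "f = (\<Sum>t\<in>T. u (g t) *\<^sub>R g t)"
    using T U(3) by (simp add: sum.reindex)
  ultimately show ?thesis
    using that[of T "\<lambda>t. u (g t)"] T(1) by simp
qed

lemma independent_spikes: "independent (spike ` {0<..<1})"
proof (rule independent_imageI)
  fix T :: "real set" and c :: "real \<Rightarrow> real"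
  assume "finite T" "T \<subseteq> {0<..<1}" "\<exists>t\<in>T. c t \<noteq> 0"
  then show "(\<Sum>t\<in>T. c t *\<^sub>R spike t) \<noteq> 0"
    by (intro spike_combination_nonzero) auto
qed

definition spike_space :: "(real \<Rightarrow> real) set" where
  "spike_space = span (spike ` {0<..<1})"

lemma spike_space_subset: "spike_space \<subseteq> Y_space"
  unfolding spike_space_def
  by (rule span_minimal) (auto intro: spike_in_Y_space subspace_Y_space)

lemma spike_space_subset_A_inf: "spike_space - {0} \<subseteq> A_inf"
proof
  fix f assume f: "f \<in> spike_space - {0}"
  then have "f \<in> span (spike ` {0<..<1})"
    by (simp add: spike_space_def)
  then obtain T c where T: "finite T" "T \<subseteq> {0<..<1}" and feq: "f = (\<Sum>t\<in>T. c t *\<^sub>R spike t)"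
    by (rule span_image_explicit)
  have "\<exists>t\<in>T. c t \<noteq> 0"
  proof (rule ccontr)
    assume "\<not> ?thesis"
    then have "f = 0"
      unfolding feq by (intro sum.neutral) auto
    then show False
      using f by simp
  qed
  then have "filterlim (\<lambda>n. \<bar>f (real n)\<bar>) at_top sequentially"
    unfolding feq using T by (intro spike_combination_at_top) auto
  then show "f \<in> A_inf"
    using f spike_space_subset by (auto simp: A_inf_def Limsup_abs_eq_infinity)
qed


section \<open>Cardinalities\<close>

text \<open>
  Continuity from the right is enough: two functions that differ at \<open>x \<ge> 0\<close> differ on a whole
  interval to the right of \<open>x\<close>, also at the endpoint \<open>0\<close>, and this interval contains a rational.
\<close>

lemma Y_space_eqI:
  assumes f: "f \<in> Y_space" and g: "g \<in> Y_space"
    and eq: "\<And>q. q \<in> \<rat> \<Longrightarrow> f q = g q"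
  shows "f = g"
proof
  fix x :: real
  have cont: "((\<lambda>y. h y) \<longlongrightarrow> h x) (at_right x)" if h: "h \<in> Y_space" and x: "x \<ge> 0" for h
  proof -
    obtain D where D: "\<forall>x\<ge>0. D 0 x = h x"
      "\<forall>n. \<forall>x\<ge>0. (D n has_real_derivative D (Suc n) x) (at x within {0..})"
      using h unfolding Y_space_def smooth_halfline_def by blast
    have "(D 0 \<longlongrightarrow> D 0 x) (at x within {0..})"
      using D x DERIV_continuous continuous_within by blast
    then have "(D 0 \<longlongrightarrow> D 0 x) (at_right x)"
      using x by (elim tendsto_within_subset) auto
    then have "(D 0 \<longlongrightarrow> h x) (at_right x)"
      using D x by simp
    moreover have "eventually (\<lambda>y. D 0 y = h y) (at_right x)"
      using D x by (auto simp: eventually_at_right_less eventually_mono[OF eventually_at_right_less])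
    ultimately show ?thesis
      by (rule Lim_transform_eventually)
  qed
  show "f x = g x"
  proof (cases "x < 0")
    case True
    then show ?thesis
      using f g by (simp add: Y_space_def smooth_halfline_def)
  next
    case False
    show ?thesis
    proof (rule ccontr)
      assume "f x \<noteq> g x"
      moreover have "((\<lambda>y. f y - g y) \<longlongrightarrow> f x - g x) (at_right x)"
        using False f g by (intro tendsto_diff cont) auto
      ultimately have "eventually (\<lambda>y. f y - g y \<noteq> 0) (at_right x)"
        by (intro tendsto_imp_eventually_ne) auto
      then obtain b where b: "b > x" "\<And>y. y > x \<Longrightarrow> y < b \<Longrightarrow> f y - g y \<noteq> 0"
        unfolding eventually_at_right_field by blast
      obtain q where "q \<in> \<rat>" "x < q" "q < b"
        using Rats_dense_in_real[OF b(1)] by blast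
      then show False
        using b(2)[of q] eq[of q] by simp
    qed
  qed
qed

text \<open>
  Each value at a rational is recorded by the set of rationals below it, its Dedekind cut. This
  makes a sequence of functions a single subset of a countable set.
\<close>

lemma card_Y_seq_le: "|Y_seq| \<le>o |UNIV :: real set|"
proof -
  define code :: "(nat \<Rightarrow> real \<Rightarrow> real) \<Rightarrow> nat set" where
    "code F = to_nat ` {(n, p :: rat, q :: rat). of_rat q < F n (of_rat p)}" for F
  have "inj_on code Y_seq"
  proof (rule inj_onI)
    fix F G assume FG: "F \<in> Y_seq" "G \<in> Y_seq" "code F = code G"
    then have *: "{(n, p :: rat, q :: rat). of_rat q < F n (of_rat p)} = {(n, p, q). of_rat q < G n (of_rat p)}"
      unfolding code_def by (simp add: inj_image_eq_iff)
    have lt: "of_rat q < F n (of_rat p) \<longleftrightarrow> of_rat q < G n (of_rat p)" for n p and q :: rat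
      using * by (auto simp: set_eq_iff)
    have "F n (of_rat p) = G n (of_rat p)" for n p
      using lt[of _ n p] of_rat_dense[of "F n (of_rat p)" "G n (of_rat p)"]
        of_rat_dense[of "G n (of_rat p)" "F n (of_rat p)"] by (metis linorder_neqE not_less_iff_gr_or_eq)
    then have "F n = G n" for n
      using FG by (intro Y_space_eqI) (auto simp: Y_seq_def elim!: Rats_cases)
    then show "F = G"
      by blast
  qed
  then have "|Y_seq| \<le>o |UNIV :: nat set set|"
    using card_of_ordLeq by blast
  moreover have "|UNIV :: nat set set| \<le>o |UNIV :: real set|"
    using nat_sets_eqpoll_reals card_of_ordIsoI unfolding eqpoll_def by (blast intro: ordIso_imp_ordLeq)
  ultimately show ?thesis
    by (rule ordLeq_transitive)
qed

lemma card_Y_space_le: "|Y_space| \<le>o |UNIV :: real set|"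
proof -
  have "inj_on (\<lambda>f n. f) Y_space" "(\<lambda>f n. f) ` Y_space \<subseteq> Y_seq"
    by (auto simp: inj_on_def fun_eq_iff Y_seq_def)
  then have "|Y_space| \<le>o |Y_seq|"
    using card_of_ordLeq by blast
  then show ?thesis
    using card_Y_seq_le by (rule ordLeq_transitive)
qed

text \<open>
  The lower bound comes from extending \<open>B\<close> to a basis of \<open>Y\<close>, the upper bound from the fact that
  such a basis is a subset of \<open>Y\<close>.
\<close>

lemma hamel_dim_span_eq:
  assumes B: "independent B" "B \<subseteq> Y" and Y: "subspace Y" "|Y| \<le>o |B|"
  shows "hamel_dim (span B) =o hamel_dim Y"
proof -
  obtain C where C: "B \<subseteq> C" "C \<subseteq> Y" "independent C" "Y \<subseteq> span C"
    using maximal_independent_subset_extend[OF B(2,1)] by blast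
  then have "hamel_basis C Y"
    using span_minimal[OF C(2) Y(1)] by (auto simp: hamel_basis_def)
  then have dimY: "hamel_dim Y =o |C|"
    by (rule hamel_dim_eq)
  have dimB: "hamel_dim (span B) =o |B|"
    using B by (intro hamel_dim_eq) (simp add: hamel_basis_def)
  have "|B| \<le>o |C|" "|C| \<le>o |Y|"
    using C by (auto intro: card_of_mono1)
  then have "|B| =o |C|"
    using Y(2) ordLeq_transitive by (auto simp: ordIso_iff_ordLeq)
  with dimB have "hamel_dim (span B) =o |C|"
    by (rule ordIso_transitive)
  then show ?thesis
    using dimY ordIso_symmetric ordIso_transitive by blast
qed

lemma infinite_dimensional_span:
  assumes "independent B" "infinite B"
  shows "infinite_dimensional (span B)"
proof -
  have "hamel_basis B (span B)"
    using assms by (simp add: hamel_basis_def)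
  then have "infinite B'" if "hamel_basis B' (span B)" for B'
    using hamel_basis_le[OF _ that] assms(2) card_of_ordLeq_finite by blast
  then show ?thesis
    unfolding infinite_dimensional_def by blast
qed

text \<open>
  Once the ambient space has at most the cardinality of the continuum, maximal lineability reduces
  to finding continuum many independent vectors with span in the set, and no dimension has to be
  computed exactly.
\<close>

lemma maximal_lineable_span:
  assumes B: "independent B" "|UNIV :: real set| \<le>o |B|"
    and Y: "subspace Y" "|Y| \<le>o |UNIV :: real set|" "span B \<subseteq> Y"
    and A: "A \<subseteq> Y" "span B - {0} \<subseteq> A"
  shows "maximal_lineable Y A"
proof -
  have "B \<subseteq> Y"
    using Y(3) span_superset by blast
  moreover have "|Y| \<le>o |B|"
    using Y(2) B(2) by (rule ordLeq_transitive)
  ultimately have "hamel_dim (span B) =o hamel_dim Y"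
    using B(1) Y(1) by (intro hamel_dim_span_eq)
  moreover have "infinite B"
    using card_of_ordLeq_finite[OF B(2)] infinite_UNIV_char_0 by blast
  then have "infinite_dimensional (span B)"
    using B(1) by (intro infinite_dimensional_span)
  ultimately show ?thesis
    using A Y(3) subspace_span unfolding maximal_lineable_def by blast
qed

lemma card_spikes: "|UNIV :: real set| \<le>o |spike ` {0<..<1}|"
proof -
  have "(UNIV :: real set) \<approx> {0<..<1::real}"
    using open_interval_eqpoll_reals[of 0 1] eqpoll_sym by auto
  then have "|UNIV :: real set| =o |{0<..<1::real}|"
    unfolding eqpoll_def by (blast intro: card_of_ordIsoI)
  moreover have "inj_on spike {0<..<1}"
    by (rule inj_on_subset[OF inj_spike]) auto
  then have "|{0<..<1::real}| \<le>o |spike ` {0<..<1}|"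
    using card_of_ordLeq by blast
  ultimately show ?thesis
    by (rule ordIso_ordLeq_trans)
qed


section \<open>Sequences\<close>

text \<open>
  By Markov's inequality \<open>\<bar>f\<bar>\<close> exceeds a large \<open>K\<close> only on a set of measure at most \<open>\<epsilon>\<close>, and
  off this set the quotients are bounded by \<open>K / (n + 1)\<close>.
\<close>

lemma almost_uniform_limit_divide:
  assumes "set_integrable lebesgue {0..} f"
  shows "almost_uniform_limit (\<lambda>n x. f x / real (Suc n)) (\<lambda>x. 0)"
  unfolding almost_uniform_limit_def
proof (intro allI impI)
  fix \<epsilon> :: real assume \<epsilon>: "\<epsilon> > 0"
  have abs_f: "set_integrable lebesgue {0..} (\<lambda>x. \<bar>f x\<bar>)"
    using assms by (rule set_integrable_abs)
  define I where "I = (LINT x:{0..}|lebesgue. \<bar>f x\<bar>)"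
  have "I \<ge> 0"
    unfolding I_def set_lebesgue_integral_def by simp
  (* Adding 1 keeps K positive when f vanishes almost everywhere. *)
  define K where "K = (I + 1) / \<epsilon>"
  have K: "K > 0"
    using \<open>I \<ge> 0\<close> \<epsilon> by (simp add: K_def)
  define E where "E = {x \<in> {0..}. K \<le> \<bar>f x\<bar>}"
  have "E = {x. K \<le> indicator {0..} x *\<^sub>R \<bar>f x\<bar>}"
    using K by (auto simp: E_def indicator_def)
  moreover have "(\<lambda>x. indicator {0..} x *\<^sub>R \<bar>f x\<bar>) \<in> borel_measurable lebesgue"
    using abs_f unfolding set_integrable_def by (rule borel_measurable_integrable)
  ultimately have meas: "E \<in> sets lebesgue"
    using borel_measurable_iff_ge[of "\<lambda>x. indicator {0..} x *\<^sub>R \<bar>f x\<bar>" lebesgue] by simp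
  have "emeasure lebesgue E \<le> ennreal (1 / K * I)"
    unfolding E_def I_def using abs_f K by (intro integral_Markov_inequality') auto
  also have "\<dots> \<le> ennreal \<epsilon>"
    using \<open>I \<ge> 0\<close> \<epsilon> by (intro ennreal_leI) (simp add: K_def field_simps)
  finally have small: "emeasure lebesgue E \<le> ennreal \<epsilon>" .
  have "uniform_limit ({0..} - E) (\<lambda>n x. f x / real (Suc n)) (\<lambda>x. 0) sequentially"
  proof (rule uniform_limitI)
    fix e :: real assume "e > 0"
    have "(\<lambda>n. K / real (Suc n)) \<longlonglongrightarrow> 0"
      by real_asymp
    then have "eventually (\<lambda>n. K / real (Suc n) < e) sequentially"
      using \<open>e > 0\<close> by (rule order_tendstoD)
    then show "\<forall>\<^sub>F n in sequentially. \<forall>x\<in>{0..} - E. dist (f x / real (Suc n)) 0 < e"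
    proof eventually_elim
      case (elim n)
      have "\<bar>f x\<bar> / real (Suc n) < e" if "x \<in> {0..} - E" for x
      proof -
        have "\<bar>f x\<bar> / real (Suc n) \<le> K / real (Suc n)"
          using that by (intro divide_right_mono) (auto simp: E_def)
        then show ?thesis
          using elim by simp
      qed
      then show ?case
        by (simp add: dist_real_def)
    qed
  qed
  then show "\<exists>E\<subseteq>{0..}. E \<in> sets lebesgue \<and> emeasure lebesgue E \<le> ennreal \<epsilon> \<and>
      uniform_limit ({0..} - E) (\<lambda>n x. f x / real (Suc n)) (\<lambda>x. 0) sequentially"
    using meas small by (intro exI[of _ E]) (auto simp: E_def)
qed

lemma L1_norm_divide: "L1_norm (\<lambda>x. f x / real (Suc n)) = L1_norm f / real (Suc n)"
  by (simp add: L1_norm_def abs_divide)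

definition harmonic_seq :: "(real \<Rightarrow> real) \<Rightarrow> nat \<Rightarrow> real \<Rightarrow> real" where
  "harmonic_seq f n = inverse (real (Suc n)) *\<^sub>R f"

lemma harmonic_seq_eq: "harmonic_seq f n = (\<lambda>x. f x / real (Suc n))"
  by (simp add: harmonic_seq_def fun_eq_iff divide_inverse mult.commute)

lemma linear_harmonic_seq: "linear harmonic_seq"
  by (rule linearI) (auto simp: harmonic_seq_def fun_eq_iff algebra_simps)

lemma inj_harmonic_seq: "inj harmonic_seq"
proof (rule injI)
  fix f g assume "harmonic_seq f = harmonic_seq g"
  then have "harmonic_seq f 0 = harmonic_seq g 0"
    by simp
  then show "f = g"
    by (simp add: harmonic_seq_def)
qed

text \<open>
  Every term is a nonzero multiple of \<open>f\<close>, hence again a nonzero element of the span, so it is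
  unbounded by the result for single functions.
\<close>

lemma harmonic_seq_in_A0_inf:
  assumes "f \<in> spike_space" "f \<noteq> 0"
  shows "harmonic_seq f \<in> A0_inf"
proof -
  have "harmonic_seq f n \<in> spike_space - {0}" for n
    using assms by (simp add: harmonic_seq_def spike_space_def span_scale)
  then have "\<forall>n. harmonic_seq f n \<in> A_inf"
    using spike_space_subset_A_inf by blast
  moreover have "(\<lambda>n. L1_norm f / real (Suc n)) \<longlonglongrightarrow> 0"
    by (rule LIMSEQ_Suc[OF lim_const_over_n])
  then have "(\<lambda>n. L1_norm (harmonic_seq f n)) \<longlonglongrightarrow> 0"
    unfolding harmonic_seq_eq L1_norm_divide .
  moreover have "set_integrable lebesgue {0..} f"
    using assms spike_space_subset by (auto simp: Y_space_def)
  then have "almost_uniform_limit (harmonic_seq f) (\<lambda>x. 0)"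
    unfolding harmonic_seq_eq[abs_def] by (rule almost_uniform_limit_divide)
  ultimately show ?thesis
    by (simp add: A0_inf_def)
qed

theorem mainTheorem8:
  shows "maximal_lineable Y_space A_inf \<and> maximal_lineable Y_seq A0_inf"
proof
  let ?B = "spike ` {0<..<1}"
  show "maximal_lineable Y_space A_inf"
  proof (rule maximal_lineable_span)
    show "span ?B \<subseteq> Y_space" "span ?B - {0} \<subseteq> A_inf"
      using spike_space_subset spike_space_subset_A_inf by (simp_all add: spike_space_def)
    show "A_inf \<subseteq> Y_space"
      by (auto simp: A_inf_def)
  qed (fact independent_spikes card_spikes subspace_Y_space card_Y_space_le)+
  let ?C = "harmonic_seq ` ?B"
  have span: "span ?C = harmonic_seq ` spike_space"
    using linear_span_image[OF linear_harmonic_seq] by (simp add: spike_space_def)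
  show "maximal_lineable Y_seq A0_inf"
  proof (rule maximal_lineable_span)
    show "independent ?C"
      using linear_independent_injective_image[OF linear_harmonic_seq independent_spikes]
        inj_on_subset[OF inj_harmonic_seq] by blast
    have "|?B| \<le>o |?C|"
      using inj_on_subset[OF inj_harmonic_seq] card_of_ordLeq by blast
    then show "|UNIV :: real set| \<le>o |?C|"
      using card_spikes ordLeq_transitive by blast
    show A: "A0_inf \<subseteq> Y_seq"
      by (auto simp: A0_inf_def A_inf_def Y_seq_def)
    have "harmonic_seq 0 = 0"
      using linear_harmonic_seq by (rule linear_0)
    then show *: "span ?C - {0} \<subseteq> A0_inf"
      using harmonic_seq_in_A0_inf unfolding span by force
    have "0 \<in> Y_seq"
      using subspace_Y_seq by (rule subspace_0)
    then show "span ?C \<subseteq> Y_seq"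
      using * A by blast
  qed (fact subspace_Y_seq card_Y_seq_le)+
qed

end
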